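(* Let $n,m\in\mathbb{N}$, let $\Sigma=\mathbb{R}^{n\times n}\times\mathbb{R}^{n\times m}$, and suppose that $\Sigma_{\text{pk}}\subset\Sigma$ is compact. Let $\alpha\in(0,1]$. Then $\Sigma_{\text{pk}}$ enables robust $\alpha$-exponential stabilization if and only if $\Sigma_{\text{pk}}\subset\Sigma_{\text{stab}}(\alpha)$. Moreover, the following statements are equivalent: (a) $\Sigma_{\text{pk}}$ enables robust stabilization. (b) $\Sigma_{\text{pk}}$ enables robust exponential stabilization. (c) $\Sigma_{\text{pk}}\subset\Sigma_{\text{stab}}$.
   Context: Systems. A pair $(A,B)\in\Sigma=\mathbb{R}^{n\times n}\times\mathbb{R}^{n\times m}$ is identified with the discrete-time system $x(t+1)=Ax(t)+Bu(t)$, $t\in\mathbb{Z}_+=\{0,1,2,\dots\}$, $x(t)\in\mathbb{R}^n$, $u(t)\in\mathbb{R}^m$. Norms of vectors are Euclidean. Stabilizability. For $\alpha\in(0,1]$, $(A,B)$ is $\alpha$-stabilizable if there exists $K\in\mathbb{R}^{m\times n}$ such that every eigenvalue $\lambda$ of $A+BK$ satisfies $|\lambda|<\alpha$. $\Sigma_{\text{stab}}(\alpha)$ denotes the set of all $\alpha$-stabilizable pairs in $\Sigma$, and $\Sigma_{\text{stab}}=\Sigma_{\text{stab}}(1)$. Closed loop. For $p\in\mathbb{N}$ (positive integers) and functions $f:\mathbb{R}^n\times\mathbb{R}^p\to\mathbb{R}^p$, $g:\mathbb{R}^n\times\mathbb{R}^p\to\mathbb{R}^m$ (arbitrary functions,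 no continuity required), the closed-loop system is $$x(t+1)=Ax(t)+Bg(x(t),z(t)),\qquad z(t+1)=f(x(t),z(t)).$$ Its solution from $x(0)=x_0$, $z(0)=z_0$ is denoted $x(t,x_0,z_0)$, $z(t,x_0,z_0)$. Partial stability. The closed-loop system is Lyapunov stable with respect to $x$ if for every $\varepsilon>0$ there exists $\delta>0$ such that $\|x_0\|\le\delta$ implies $\|x(t,x_0,z_0)\|\le\varepsilon$ for all $t\in\mathbb{Z}_+$ and all $z_0\in\mathbb{R}^p$. It is globally asymptotically stable with respect to $x$ if it is Lyapunov stable with respect to $x$ and $\lim_{t\to\infty}x(t,x_0,z_0)=0$ for every $x_0\in\mathbb{R}^n$ and $z_0\in\mathbb{R}^p$. Robust stabilization. $\Sigma_{\text{pk}}$ enables robust stabilization if there exist $p\in\mathbb{N}$ and functions $f:\mathbb{R}^n\times\mathbb{R}^p\to\mathbb{R}^p$ and $g:\mathbb{R}^n\times\mathbb{R}^p\to\mathbb{R}^m$ (arbitrary functions, no continuity required) such that: (i) for every $(A,B)\in\Sigma_{\text{pk}}$ the closed-loop system is globally asymptotically stable with respect to $x$; and (ii) for every $x_0\in\mathbb{R}^n$, $z_0\in\mathbb{R}^p$ and $(A,B)\in\Sigma_{\text{pk}}$, $z(t,x_0,z_0)$ is bounded (as a function of $t\in\mathbb{Z}_+$). Robust $\alpha$-exponential stabilization. For $\alpha\in(0,1]$, $\Sigma_{\text{pk}}$ enables robust $\alpha$-exponential stabilization if there exist $p\in\mathbb{N}$ and functions $f:\mathbb{R}^n\times\mathbb{R}^p\to\mathbb{R}^p$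 and $g:\mathbb{R}^n\times\mathbb{R}^p\to\mathbb{R}^m$ (arbitrary functions, no continuity required) such that: (ii) for every $x_0\in\mathbb{R}^n$, $z_0\in\mathbb{R}^p$ and $(A,B)\in\Sigma_{\text{pk}}$, $z(t,x_0,z_0)$ is bounded (as a function of $t\in\mathbb{Z}_+$); and (iii) there exist $c\ge1$ and $\eta\in[0,\alpha)$ such that for every $(A,B)\in\Sigma_{\text{pk}}$, $x_0\in\mathbb{R}^n$ and $z_0\in\mathbb{R}^p$, we have $\|x(t,x_0,z_0)\|\le c\,\eta^t\|x_0\|$ for all $t\in\mathbb{Z}_+$. When $\alpha=1$ one says that $\Sigma_{\text{pk}}$ enables robust exponential stabilization. *)

theory Defs
  imports "HOL-Analysis.Analysis"
begin

type_synonym ('n, 'm) sys = "(real^'n^'n) \<times> (real^'m^'n)"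

text \<open>Eigenvalues of a real matrix are complex, with complex eigenvectors.\<close>

definition complex_eigenvalue :: "real^'n^'n \<Rightarrow> complex \<Rightarrow> bool" where
  "complex_eigenvalue M l \<longleftrightarrow>
     (\<exists>v :: complex^'n. v \<noteq> 0 \<and> map_matrix complex_of_real M *v v = l *s v)"

definition stabilizable :: "real \<Rightarrow> ('n::finite, 'm::finite) sys \<Rightarrow> bool" where
  "stabilizable \<alpha> = (\<lambda>(A, B). \<exists>K :: real^'n^'m.
     \<forall>l. complex_eigenvalue (A + B ** K) l \<longrightarrow> norm l < \<alpha>)"

definition Sigma_stab :: "real \<Rightarrow> ('n::finite, 'm::finite) sys set" where
  "Sigma_stab \<alpha> = {S. stabilizable \<alpha> S}"

text \<open>
  The dimension \<open>p\<close> of the controller state is existentially quantified in the notions below,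
  so it cannot be a type. Elements of $\mathbb{R}^p$ are represented as in
  \<open>Euclidean_space p\<close>, by functions on the naturals that vanish from \<open>p\<close> on. Controller maps
  are total on \<open>nat \<Rightarrow> real\<close>, but only their behaviour on \<open>Rspace p\<close> matters.
\<close>

definition Rspace :: "nat \<Rightarrow> (nat \<Rightarrow> real) set" where
  "Rspace p = topspace (Euclidean_space p)"

primrec closed_loop ::
  "('n::finite, 'm::finite) sys \<Rightarrow> (real^'n \<Rightarrow> (nat \<Rightarrow> real) \<Rightarrow> (nat \<Rightarrow> real)) \<Rightarrow>
   (real^'n \<Rightarrow> (nat \<Rightarrow> real) \<Rightarrow> real^'m) \<Rightarrow> real^'n \<Rightarrow> (nat \<Rightarrow> real) \<Rightarrow> nat \<Rightarrow>
   (real^'n) \<times> (nat \<Rightarrow> real)" where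
  "closed_loop S f g x0 z0 0 = (x0, z0)"
| "closed_loop S f g x0 z0 (Suc t) =
     (let (x, z) = closed_loop S f g x0 z0 t
      in (fst S *v x + snd S *v g x z, f x z))"

definition xsol ::
  "('n::finite, 'm::finite) sys \<Rightarrow> (real^'n \<Rightarrow> (nat \<Rightarrow> real) \<Rightarrow> (nat \<Rightarrow> real)) \<Rightarrow>
   (real^'n \<Rightarrow> (nat \<Rightarrow> real) \<Rightarrow> real^'m) \<Rightarrow> real^'n \<Rightarrow> (nat \<Rightarrow> real) \<Rightarrow> nat \<Rightarrow> real^'n" where
  "xsol S f g x0 z0 t = fst (closed_loop S f g x0 z0 t)"

definition zsol ::
  "('n::finite, 'm::finite) sys \<Rightarrow> (real^'n \<Rightarrow> (nat \<Rightarrow> real) \<Rightarrow> (nat \<Rightarrow> real)) \<Rightarrow>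
   (real^'n \<Rightarrow> (nat \<Rightarrow> real) \<Rightarrow> real^'m) \<Rightarrow> real^'n \<Rightarrow> (nat \<Rightarrow> real) \<Rightarrow> nat \<Rightarrow> (nat \<Rightarrow> real)" where
  "zsol S f g x0 z0 t = snd (closed_loop S f g x0 z0 t)"

definition Lyapunov_stable_x ::
  "nat \<Rightarrow> ('n::finite, 'm::finite) sys \<Rightarrow> (real^'n \<Rightarrow> (nat \<Rightarrow> real) \<Rightarrow> (nat \<Rightarrow> real)) \<Rightarrow>
   (real^'n \<Rightarrow> (nat \<Rightarrow> real) \<Rightarrow> real^'m) \<Rightarrow> bool" where
  "Lyapunov_stable_x p S f g \<longleftrightarrow>
     (\<forall>\<epsilon>>0. \<exists>\<delta>>0. \<forall>x0. norm x0 \<le> \<delta> \<longrightarrow>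
        (\<forall>t. \<forall>z0\<in>Rspace p. norm (xsol S f g x0 z0 t) \<le> \<epsilon>))"

definition globally_asymptotically_stable_x ::
  "nat \<Rightarrow> ('n::finite, 'm::finite) sys \<Rightarrow> (real^'n \<Rightarrow> (nat \<Rightarrow> real) \<Rightarrow> (nat \<Rightarrow> real)) \<Rightarrow>
   (real^'n \<Rightarrow> (nat \<Rightarrow> real) \<Rightarrow> real^'m) \<Rightarrow> bool" where
  "globally_asymptotically_stable_x p S f g \<longleftrightarrow>
     Lyapunov_stable_x p S f g \<and>
     (\<forall>x0. \<forall>z0\<in>Rspace p. (\<lambda>t. xsol S f g x0 z0 t) \<longlonglongrightarrow> 0)"

text \<open>
  Boundedness of \<open>z\<close> refers to the Euclidean norm on $\mathbb{R}^p$. The constant \<open>bounded\<close> on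
  \<open>nat \<Rightarrow> real\<close> would not do: the metric which the library puts on that type is itself bounded.
\<close>

definition bounded_z ::
  "nat \<Rightarrow> ('n::finite, 'm::finite) sys set \<Rightarrow>
   (real^'n \<Rightarrow> (nat \<Rightarrow> real) \<Rightarrow> (nat \<Rightarrow> real)) \<Rightarrow>
   (real^'n \<Rightarrow> (nat \<Rightarrow> real) \<Rightarrow> real^'m) \<Rightarrow> bool" where
  "bounded_z p \<Sigma> f g \<longleftrightarrow>
     (\<forall>x0. \<forall>z0\<in>Rspace p. \<forall>S\<in>\<Sigma>. \<exists>M. \<forall>t. L2_set (zsol S f g x0 z0 t) {..<p} \<le> M)"

definition enables_robust_stabilization :: "('n::finite, 'm::finite) sys set \<Rightarrow> bool" where
  "enables_robust_stabilization \<Sigma> \<longleftrightarrow>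
     (\<exists>p\<ge>1. \<exists>(f :: real^'n \<Rightarrow> (nat \<Rightarrow> real) \<Rightarrow> (nat \<Rightarrow> real))
        (g :: real^'n \<Rightarrow> (nat \<Rightarrow> real) \<Rightarrow> real^'m).
        (\<forall>x. \<forall>z\<in>Rspace p. f x z \<in> Rspace p) \<and>
        (\<forall>S\<in>\<Sigma>. globally_asymptotically_stable_x p S f g) \<and>
        bounded_z p \<Sigma> f g)"

definition enables_robust_exp_stabilization ::
  "real \<Rightarrow> ('n::finite, 'm::finite) sys set \<Rightarrow> bool" where
  "enables_robust_exp_stabilization \<alpha> \<Sigma> \<longleftrightarrow>
     (\<exists>p\<ge>1. \<exists>(f :: real^'n \<Rightarrow> (nat \<Rightarrow> real) \<Rightarrow> (nat \<Rightarrow> real))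
        (g :: real^'n \<Rightarrow> (nat \<Rightarrow> real) \<Rightarrow> real^'m).
        (\<forall>x. \<forall>z\<in>Rspace p. f x z \<in> Rspace p) \<and>
        bounded_z p \<Sigma> f g \<and>
        (\<exists>c\<ge>1. \<exists>\<eta>\<in>{0..<\<alpha>}. \<forall>S\<in>\<Sigma>. \<forall>x0. \<forall>z0\<in>Rspace p. \<forall>t.
           norm (xsol S f g x0 z0 t) \<le> c * \<eta> ^ t * norm x0))"

end

theory Submission
  imports Defs "HOL-Computational_Algebra.Fundamental_Theorem_Algebra"
begin

text \<open>
  If every plant is stabilizable, each one has a gain \<open>K\<close> and a norm \<open>V\<close> that decreases by a
  factor \<open>\<eta> < \<alpha>\<close> along the closed loop, also for all plants nearby. By compactness finitely many
  pairs \<open>(K, V)\<close> serve all plants. The controller remembers the current pair and the bound that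
  \<open>V\<close> should satisfy at the next state. When the bound is violated it moves on cyclically. A pair
  that suits the plant can only be abandoned at time \<open>0\<close>, when the remembered bound is arbitrary, so
  the number of switches is bounded, and each of them costs a bounded factor.

  Conversely, a robust controller steers each plant from every state to \<open>0\<close> at the rate \<open>\<alpha>\<close>.
  The static linear gain that fits best, in the sense of least squares, sufficiently long
  trajectories from the unit vectors is then stabilizing.
\<close>

section \<open>Powers of a matrix with small eigenvalues\<close>

text \<open>This is p(N) v, written with the iterates of \<open>v\<close>, so that annihilation of a
  single vector is expressed without polynomials of matrices.\<close>

definition poly_act :: "'a::field^'n^'n \<Rightarrow> 'a poly \<Rightarrow> 'a^'n \<Rightarrow> 'a^'n" where
  "poly_act N p v = (\<Sum>i\<le>degree p. coeff p i *s (((*v) N ^^ i) v))"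

lemma poly_act_eq_sum:
  assumes "degree p \<le> n"
  shows "poly_act N p v = (\<Sum>i\<le>n. coeff p i *s (((*v) N ^^ i) v))"
  unfolding poly_act_def
  by (rule sum.mono_neutral_left) (use assms in \<open>auto simp: coeff_eq_0\<close>)

lemma poly_act_0 [simp]: "poly_act N 0 v = 0"
  by (simp add: poly_act_def)

lemma poly_act_add: "poly_act N (p + q) v = poly_act N p v + poly_act N q v"
proof -
  let ?n = "max (degree p) (degree q)"
  have "degree (p + q) \<le> ?n" by (rule degree_add_le) auto
  then show ?thesis
    by (simp add: poly_act_eq_sum[of _ ?n] sum.distrib vec.scale_left_distrib)
qed

lemma poly_act_smult: "poly_act N (smult a p) v = a *s poly_act N p v"
  by (cases "a = 0") (simp_all add: poly_act_def vec.scale_sum_right)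

lemma poly_act_pCons_0: "poly_act N (pCons 0 p) v = N *v poly_act N p v"
proof -
  have "poly_act N (pCons 0 p) v
      = (\<Sum>i\<le>Suc (degree p). coeff (pCons 0 p) i *s (((*v) N ^^ i) v))"
    by (rule poly_act_eq_sum) (simp add: degree_pCons_eq_if)
  also have "\<dots> = (\<Sum>i\<le>degree p. coeff p i *s (((*v) N ^^ Suc i) v))"
    by (subst sum.atMost_Suc_shift) simp
  also have "\<dots> = N *v poly_act N p v"
    by (simp add: poly_act_def vec.sum vec.scale)
  finally show ?thesis .
qed

lemma funpow_matrix_commute: "((*v) N ^^ t) (N *v v) = N *v (((*v) N ^^ t) v)"
  by (induction t) auto

lemma funpow_matrix_diff:
  fixes N :: "'a::field^'n^'n"
  shows "((*v) N ^^ t) (v - w) = ((*v) N ^^ t) v - ((*v) N ^^ t) w"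
  by (induction t) (auto simp: vec.diff)

lemma funpow_matrix_scale:
  fixes N :: "'a::field^'n^'n"
  shows "((*v) N ^^ t) (c *s v) = c *s ((*v) N ^^ t) v"
  by (induction t) (auto simp: vec.scale)

lemma poly_act_diff_right: "poly_act N p (v - w) = poly_act N p v - poly_act N p w"
  by (simp add: poly_act_def funpow_matrix_diff vec.scale_right_diff_distrib sum_subtractf)

lemma poly_act_scale_right: "poly_act N p (c *s v) = c *s poly_act N p v"
  by (simp add: poly_act_def funpow_matrix_scale vec.scale_sum_right mult.commute)

lemma poly_act_matrix_right: "poly_act N p (N *v v) = N *v poly_act N p v"
  by (simp add: poly_act_def funpow_matrix_commute vec.sum vec.scale)

lemma poly_act_linear_factor:
  "poly_act N ([:-l, 1:] * q) v = N *v poly_act N q v - l *s poly_act N q v"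
proof -
  have eq: "[:-l, 1:] * q = smult (-l) q + pCons 0 q" by simp
  show ?thesis unfolding eq poly_act_add poly_act_smult poly_act_pCons_0 by simp
qed

text \<open>Otherwise all iterates of \<open>v\<close> would be linearly independent, more of them
  than the dimension allows.\<close>

lemma exists_annihilating_poly:
  fixes N :: "'a::field^'n^'n"
  shows "\<exists>p. p \<noteq> 0 \<and> poly_act N p v = 0"
proof (rule ccontr)
  assume "\<not> ?thesis"
  then have no: "p = 0" if "poly_act N p v = 0" for p using that by blast
  let ?y = "\<lambda>i. ((*v) N ^^ i) v"
  have indep: "vec.independent (?y ` {..<k}) \<and> card (?y ` {..<k}) = k" for k
  proof (induction k)
    case 0
    show ?case by (simp add: vec.independent_empty)
  next
    case (Suc k)
    \<comment> \<open>The vectors p(N) v with p of degree below \<open>k\<close>. The vanishing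
      coefficient, in place of a strict inequality, still admits p = 0 when \<open>k\<close> is
      0.\<close>
    let ?Z = "{w. \<exists>p. coeff p k = 0 \<and> degree p \<le> k \<and> w = poly_act N p v}"
    have "vec.subspace ?Z"
      unfolding vec.subspace_def
    proof (intro conjI ballI allI)
      show "0 \<in> ?Z" by (auto intro!: exI[of _ 0])
    next
      fix a b assume "a \<in> ?Z" "b \<in> ?Z"
      then obtain p q where "coeff p k = 0" "degree p \<le> k" "a = poly_act N p v"
        "coeff q k = 0" "degree q \<le> k" "b = poly_act N q v" by blast
      then show "a + b \<in> ?Z"
        by (intro CollectI exI[of _ "p + q"]) (auto simp: poly_act_add degree_add_le)
    next
      fix c a assume "a \<in> ?Z"
      then obtain p where "coeff p k = 0" "degree p \<le> k" "a = poly_act N p v" by blast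
      then show "c *s a \<in> ?Z"
        by (intro CollectI exI[of _ "smult c p"])
          (auto simp: poly_act_smult intro: order_trans[OF degree_smult_le])
    qed
    have monom: "poly_act N (monom 1 i) v = ?y i" for i
    proof -
      have "poly_act N (monom 1 i) v = (\<Sum>j\<le>i. if j = i then ?y i else 0)"
        unfolding poly_act_eq_sum[OF degree_monom_le] by (rule sum.cong) auto
      then show ?thesis by simp
    qed
    have "?y ` {..<k} \<subseteq> ?Z"
    proof
      fix w assume "w \<in> ?y ` {..<k}"
      then obtain i where "i < k" "w = ?y i" by blast
      then show "w \<in> ?Z"
        by (intro CollectI exI[of _ "monom 1 i"])
          (auto simp: monom intro: order_trans[OF degree_monom_le])
    qed
    then have span: "vec.span (?y ` {..<k}) \<subseteq> ?Z"
      using \<open>vec.subspace ?Z\<close> by (rule vec.span_minimal)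
    have notin: "?y k \<notin> vec.span (?y ` {..<k})"
    proof
      assume "?y k \<in> vec.span (?y ` {..<k})"
      then obtain p where p: "coeff p k = 0" "?y k = poly_act N p v" using span by blast
      \<comment> \<open>X^k - p would annihilate \<open>v\<close>, although its coefficient at
        \<open>k\<close> is 1.\<close>
      have "poly_act N (monom 1 k + smult (-1) p) v = 0"
        unfolding poly_act_add poly_act_smult monom p(2)[symmetric] by simp
      then have "monom 1 k + smult (-1) p = 0" by (rule no)
      then have "coeff (monom 1 k + smult (-1) p) k = 0" by simp
      then show False using p(1) by simp
    qed
    then have "?y k \<notin> ?y ` {..<k}" by (rule contrapos_nn) (rule vec.span_base)
    then have "card (insert (?y k) (?y ` {..<k})) = Suc k"
      using Suc by (subst card_insert_disjoint) (auto simp del: funpow.simps)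
    moreover have "vec.independent (insert (?y k) (?y ` {..<k}))"
      using notin Suc by (intro vec.independent_insertI) (rule notin, rule conjunct1)
    ultimately show ?case unfolding lessThan_Suc image_insert by (rule conjI[rotated])
  qed
  have "k \<le> CARD('n)" for k
    using vec.independent_card_le_dim[of "?y ` {..<k}" UNIV] indep[of k]
    by (simp only: subset_UNIV vec_dim_card simp_thms)
  from this[of "Suc CARD('n)"] show False by simp
qed

text \<open>A contracting scalar recursion forgets its initial value and follows its input to
  0.\<close>

lemma tendsto_0_contraction:
  fixes y s :: "nat \<Rightarrow> 'a::real_normed_field"
  assumes rec: "\<And>t. y (Suc t) = c * y t + s t" and c: "norm c < 1" and s: "s \<longlonglongrightarrow> 0"
  shows "y \<longlonglongrightarrow> 0"
proof (rule LIMSEQ_I)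
  fix e :: real assume e: "0 < e"
  define r where "r = norm c"
  have r: "0 \<le> r" "r < 1" using c by (auto simp: r_def)
  have "0 < (1 - r) * (e / 2)" using r e by simp
  from LIMSEQ_D[OF s this] obtain T where T: "\<And>t. t \<ge> T \<Longrightarrow> norm (s t) < (1 - r) * (e / 2)"
    by auto
  \<comment> \<open>Once the input stays below (1 - r) e/2, the level e/2 reproduces itself, because
    r e/2 + (1 - r) e/2 = e/2.\<close>
  have bound: "norm (y (T + k)) \<le> e / 2 + r ^ k * norm (y T)" for k
  proof (induction k)
    case (Suc k)
    have "norm (y (T + Suc k)) \<le> r * norm (y (T + k)) + norm (s (T + k))"
      using norm_triangle_ineq[of "c * y (T + k)" "s (T + k)"]
      by (simp add: rec r_def norm_mult)
    also have "\<dots> \<le> r * (e / 2 + r ^ k * norm (y T)) + (1 - r) * (e / 2)"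
      using T[of "T + k"] Suc r by (intro add_mono mult_left_mono) auto
    finally show ?case by (simp add: field_simps)
  qed (use e in simp)
  have "(\<lambda>k. r ^ k * norm (y T)) \<longlonglongrightarrow> 0"
    using r by (intro tendsto_mult_left_zero LIMSEQ_power_zero) simp
  from LIMSEQ_D[OF this, of "e / 2"] e obtain k0 where
    k0: "\<And>k. k \<ge> k0 \<Longrightarrow> \<bar>r ^ k * norm (y T)\<bar> < e / 2" by auto
  show "\<exists>n0. \<forall>n\<ge>n0. norm (y n - 0) < e"
  proof (intro exI allI impI)
    fix n assume n: "n \<ge> T + k0"
    then have "norm (y n) \<le> e / 2 + r ^ (n - T) * norm (y T)" using bound[of "n - T"] by simp
    also have "\<dots> < e" using k0[of "n - T"] abs_ge_self[of "r ^ (n - T) * norm (y T)"] n by linarith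
    finally show "norm (y n - 0) < e" by simp
  qed
qed

text \<open>Peeling off one linear factor \<open>X - l\<close> of an annihilating polynomial of \<open>v\<close> either makes
  \<open>l\<close> an eigenvalue, in which case the decay is inherited from \<open>N v - l v\<close>, or leaves an
  annihilating polynomial of smaller degree.\<close>

lemma funpow_matrix_tendsto_0:
  fixes N :: "complex^'n^'n" and \<alpha> :: real
  assumes \<alpha>: "0 < \<alpha>" and ev: "\<And>l v. v \<noteq> 0 \<Longrightarrow> N *v v = l *s v \<Longrightarrow> norm l < \<alpha>"
  shows "(\<lambda>t. (((*v) N ^^ t) v) $ i / of_real \<alpha> ^ t) \<longlonglongrightarrow> 0"
proof -
  have main: "\<forall>i. (\<lambda>t. (((*v) N ^^ t) v) $ i / of_real \<alpha> ^ t) \<longlonglongrightarrow> 0"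
    if "p \<noteq> 0" "poly_act N p v = 0" for p v
    using that
  proof (induction "degree p" arbitrary: p v)
    case 0
    then obtain a where "p = [:a:]" by (metis degree_eq_zeroE)
    then have "v = 0" using 0 by (simp add: poly_act_def)
    moreover have "((*v) N ^^ t) 0 = 0" for t by (induction t) auto
    ultimately show ?case by simp
  next
    case (Suc d)
    then obtain l where "poly p l = 0"
      using fundamental_theorem_of_algebra[of p] constant_degree[of p] by auto
    then obtain q where p: "p = [:-l, 1:] * q" using poly_eq_0_iff_dvd dvdE by blast
    have "q \<noteq> 0" using Suc.prems p by auto
    then have d: "d = degree q" using Suc.hyps(2) p by (simp add: degree_mult_eq del: mult_pCons_left)
    show ?case
    proof (cases "poly_act N q v = 0")
      case True
      then show ?thesis using Suc.hyps(1) d \<open>q \<noteq> 0\<close> by blast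
    next
      case False
      have "N *v poly_act N q v = l *s poly_act N q v"
        using Suc.prems(2) unfolding p poly_act_linear_factor by simp
      then have l: "norm l < \<alpha>" using ev False by blast
      \<comment> \<open>Since q(N) commutes with N - l, it maps \<open>w\<close> to p(N) v = 0, so
        the induction hypothesis applies to \<open>w\<close>.\<close>
      define w where "w = N *v v - l *s v"
      have "poly_act N q w = 0"
        using Suc.prems(2) unfolding p poly_act_linear_factor w_def
        by (simp add: poly_act_diff_right poly_act_scale_right poly_act_matrix_right)
      then have w: "(\<lambda>t. (((*v) N ^^ t) w) $ i / of_real \<alpha> ^ t) \<longlonglongrightarrow> 0" for i
        using Suc.hyps(1) d \<open>q \<noteq> 0\<close> by blast
      show ?thesis
      proof
        fix i
        show "(\<lambda>t. (((*v) N ^^ t) v) $ i / of_real \<alpha> ^ t) \<longlonglongrightarrow> 0"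
        proof (rule tendsto_0_contraction)
          fix t
          have "((*v) N ^^ Suc t) v = l *s ((*v) N ^^ t) v + ((*v) N ^^ t) w"
            by (simp add: w_def funpow_matrix_diff funpow_matrix_scale funpow_matrix_commute)
          then have "(((*v) N ^^ Suc t) v) $ i
              = l * (((*v) N ^^ t) v) $ i + (((*v) N ^^ t) w) $ i"
            by (metis vector_add_component vector_smult_component)
          then show "(((*v) N ^^ Suc t) v) $ i / of_real \<alpha> ^ Suc t
            = l / of_real \<alpha> * ((((*v) N ^^ t) v) $ i / of_real \<alpha> ^ t)
              + (((*v) N ^^ t) w) $ i / of_real \<alpha> ^ t / of_real \<alpha>"
            using \<alpha> by (simp add: field_simps)
        next
          show "norm (l / of_real \<alpha>) < 1" using l \<alpha> by (simp add: norm_divide)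
          show "(\<lambda>t. (((*v) N ^^ t) w) $ i / of_real \<alpha> ^ t / of_real \<alpha>) \<longlonglongrightarrow> 0"
            by (intro tendsto_divide_zero w)
        qed
      qed
    qed
  qed
  show ?thesis using exists_annihilating_poly[of N v] main by blast
qed

section \<open>Contractive norms\<close>

lemma linear_funpow_matrix:
  fixes M :: "real^'n^'n"
  shows "linear ((*v) M ^^ t)"
proof (induction t)
  case 0
  show ?case by (rule linearI) simp_all
next
  case (Suc t)
  from linear_compose[OF this matrix_vector_mul_linear[of M]] show ?case by (simp add: o_def)
qed

text \<open>Complexification: the embedding \<open>c\<close> of real vectors intertwines
  \<open>M\<close> with \<open>N\<close>, so the decay can be read off entrywise.\<close>

lemma funpow_real_matrix_tendsto_0:
  fixes M :: "real^'n^'n" and \<alpha> :: real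
  assumes \<alpha>: "0 < \<alpha>" and ev: "\<And>l. complex_eigenvalue M l \<Longrightarrow> norm l < \<alpha>"
  shows "(\<lambda>t. norm (((*v) M ^^ t) x) / \<alpha> ^ t) \<longlonglongrightarrow> 0"
proof -
  define N where "N = map_matrix complex_of_real M"
  define c where "c y = (\<chi> i. complex_of_real (y $ i))" for y :: "real^'n"
  have step: "N *v c y = c (M *v y)" for y
    by (simp add: N_def c_def vec_eq_iff matrix_vector_mult_def)
  have pow: "((*v) N ^^ t) (c x) = c (((*v) M ^^ t) x)" for t
    by (induction t) (auto simp: step)
  have "(\<lambda>t. (((*v) M ^^ t) x) $ i / \<alpha> ^ t) \<longlonglongrightarrow> 0" for i
  proof -
    have "(\<lambda>t. (((*v) N ^^ t) (c x)) $ i / of_real \<alpha> ^ t) \<longlonglongrightarrow> 0"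
    proof (rule funpow_matrix_tendsto_0[OF \<alpha>])
      fix l and v :: "complex^'n" assume "v \<noteq> 0" "N *v v = l *s v"
      then show "norm l < \<alpha>" by (intro ev) (auto simp: complex_eigenvalue_def N_def)
    qed
    then have "(\<lambda>t. complex_of_real ((((*v) M ^^ t) x) $ i / \<alpha> ^ t)) \<longlonglongrightarrow> of_real 0"
      unfolding pow by (simp add: c_def)
    then show ?thesis by (simp only: tendsto_of_real_iff)
  qed
  then have "(\<lambda>t. (1 / \<alpha> ^ t) *\<^sub>R ((*v) M ^^ t) x) \<longlonglongrightarrow> 0"
    by (intro vec_tendstoI) simp
  from tendsto_norm_zero[OF this] show ?thesis using \<alpha> by simp
qed

text \<open>Decay along the finitely many unit vectors yields decay in operator norm.\<close>

lemma exists_contractive_power: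
  fixes M :: "real^'n^'n" and \<alpha> :: real
  assumes \<alpha>: "0 < \<alpha>" and ev: "\<And>l. complex_eigenvalue M l \<Longrightarrow> norm l < \<alpha>" and e: "0 < e"
  shows "\<exists>k\<ge>1. \<forall>x. norm (((*v) M ^^ k) x) \<le> e * \<alpha> ^ k * norm x"
proof -
  have "(\<lambda>t. \<Sum>i\<in>UNIV. norm (((*v) M ^^ t) (axis i 1)) / \<alpha> ^ t) \<longlonglongrightarrow> (\<Sum>i\<in>(UNIV::'n set). 0)"
    by (intro tendsto_sum funpow_real_matrix_tendsto_0 \<alpha> ev)
  then have "eventually (\<lambda>t. (\<Sum>i\<in>UNIV. norm (((*v) M ^^ t) (axis i 1)) / \<alpha> ^ t) < e) sequentially"
    using e by (intro order_tendstoD(2)) simp_all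
  from eventually_conj[OF this eventually_ge_at_top[of 1]] obtain k where
    k: "(\<Sum>i\<in>UNIV. norm (((*v) M ^^ k) (axis i 1)) / \<alpha> ^ k) < e" "1 \<le> k"
    by (auto dest: eventually_happens)
  have "norm (((*v) M ^^ k) x) \<le> e * \<alpha> ^ k * norm x" for x
  proof -
    interpret linear "(*v) M ^^ k" by (rule linear_funpow_matrix)
    have "x = (\<Sum>i\<in>UNIV. (x $ i) *\<^sub>R axis i 1)"
      using basis_expansion[of x] by (simp add: scalar_mult_eq_scaleR)
    then have "((*v) M ^^ k) x = ((*v) M ^^ k) (\<Sum>i\<in>UNIV. (x $ i) *\<^sub>R axis i 1)"
      by (rule arg_cong)
    also have "\<dots> = (\<Sum>i\<in>UNIV. (x $ i) *\<^sub>R ((*v) M ^^ k) (axis i 1))"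
      by (simp only: sum scale)
    finally have "norm (((*v) M ^^ k) x)
        \<le> (\<Sum>i\<in>UNIV. norm ((x $ i) *\<^sub>R ((*v) M ^^ k) (axis i 1)))"
      using norm_sum by metis
    also have "\<dots> \<le> (\<Sum>i\<in>UNIV. norm x * norm (((*v) M ^^ k) (axis i 1)))"
      by (intro sum_mono) (auto intro!: mult_right_mono simp: component_le_norm_cart)
    also have "\<dots> = (\<Sum>i\<in>UNIV. norm (((*v) M ^^ k) (axis i 1)) / \<alpha> ^ k) * \<alpha> ^ k * norm x"
      using \<alpha> by (simp add: sum_distrib_left sum_distrib_right mult.commute)
    also have "\<dots> \<le> e * \<alpha> ^ k * norm x"
      using k \<alpha> by (intro mult_right_mono) auto
    finally show ?thesis .
  qed
  then show ?thesis using k(2) by blast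
qed

text \<open>The strict gain \<open>\<eta> / 2 * norm x\<close> leaves room for a perturbation of \<open>M\<close>.\<close>

lemma exists_contractive_norm:
  fixes M :: "real^'n^'n" and \<alpha> :: real
  assumes \<alpha>: "0 < \<alpha>" and ev: "\<And>l. complex_eigenvalue M l \<Longrightarrow> norm l < \<alpha>"
  obtains \<eta> V b where "0 < \<eta>" "\<eta> < \<alpha>" "0 < b" "\<And>x. norm x \<le> V x" "\<And>x. V x \<le> b * norm x"
    "\<And>x y. V (x + y) \<le> V x + V y" "\<And>x. V (M *v x) \<le> \<eta> * V x - \<eta> / 2 * norm x"
proof -
  from exists_contractive_power[OF \<alpha> ev, where e = "1 / 4"]
  obtain k where k: "k \<ge> 1" and k4: "\<And>x. norm (((*v) M ^^ k) x) \<le> 1 / 4 * \<alpha> ^ k * norm x"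
    by auto
  \<comment> \<open>With \<open>\<eta> ^ k = \<alpha> ^ k / 2\<close> the factor 1/4 of
    \<open>k4\<close> becomes 1/2 for the rescaled power, and \<open>\<eta>\<close> stays below
    \<open>\<alpha>\<close>.\<close>
  define \<eta> where "\<eta> = root k (\<alpha> ^ k / 2)"
  have \<eta>k: "\<eta> ^ k = \<alpha> ^ k / 2" and \<eta>: "0 < \<eta>"
    using k \<alpha> by (auto simp: \<eta>_def)
  have "\<eta> < \<alpha>"
  proof (rule power_less_imp_less_base)
    show "\<eta> ^ k < \<alpha> ^ k" using \<alpha> by (simp add: \<eta>k)
  qed (use \<alpha> in simp)
  have Mk: "norm (((*v) M ^^ k) x) / \<eta> ^ k \<le> norm x / 2" for x
    using k4[of x] \<alpha>
    by (simp add: \<eta>k field_simps)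
  \<comment> \<open>An adapted norm. Up to the factor \<open>\<eta>\<close>, applying
    \<open>M\<close> shifts the sum: \<open>norm x\<close> drops out, and a last term of at most
    \<open>norm x / 2\<close> enters. The difference is the slack.\<close>
  define V where "V x = (\<Sum>j<k. norm (((*v) M ^^ j) x) / \<eta> ^ j)" for x
  define b where "b = (\<Sum>j<k. onorm ((*v) M ^^ j) / \<eta> ^ j) + 1"
  have bl: "bounded_linear ((*v) M ^^ j)" for j
    using linear_funpow_matrix linear_conv_bounded_linear by blast
  obtain k' where k': "k = Suc k'" using k by (cases k) auto
  have V0: "V x = norm x + (\<Sum>j<k'. norm (((*v) M ^^ Suc j) x) / \<eta> ^ Suc j)" for x
    unfolding V_def k' by (subst sum.lessThan_Suc_shift) simp
  show thesis
  proof (rule that[OF \<eta> \<open>\<eta> < \<alpha>\<close>, where b = b and V = V])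
    show "0 < b" unfolding b_def
      using \<eta> by (intro add_nonneg_pos sum_nonneg divide_nonneg_nonneg onorm_pos_le bl) auto
    show "norm x \<le> V x" for x unfolding V0 using \<eta> by (simp add: sum_nonneg)
    show "V x \<le> b * norm x" for x
    proof -
      have "V x \<le> (\<Sum>j<k. onorm ((*v) M ^^ j) * norm x / \<eta> ^ j)"
        unfolding V_def using \<eta> by (intro sum_mono divide_right_mono onorm bl) auto
      also have "\<dots> \<le> b * norm x"
        by (simp add: b_def sum_distrib_right distrib_right)
      finally show ?thesis .
    qed
    show "V (x + y) \<le> V x + V y" for x y
      unfolding V_def sum.distrib[symmetric] using \<eta>
      by (intro sum_mono)
        (simp add: linear_add[OF linear_funpow_matrix] add_divide_distrib[symmetric]
          divide_right_mono norm_triangle_ineq)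
    show "V (M *v x) \<le> \<eta> * V x - \<eta> / 2 * norm x" for x
    proof -
      have "V (M *v x) = \<eta> * (\<Sum>j<k. norm (((*v) M ^^ Suc j) x) / \<eta> ^ Suc j)"
        unfolding V_def using \<eta> by (simp add: sum_distrib_left funpow_matrix_commute)
      also have "\<dots> = \<eta> * (V x - norm x + norm (((*v) M ^^ k) x) / \<eta> ^ k)"
        unfolding V0 by (simp add: k')
      also have "\<dots> \<le> \<eta> * (V x - norm x + norm x / 2)"
        using \<eta> Mk[of x] by (intro mult_left_mono add_left_mono) auto
      finally show ?thesis by (simp add: algebra_simps)
    qed
  qed
qed

text \<open>One gain and one norm serve a whole neighbourhood because the slack
  \<open>\<eta> / 2 * norm x\<close> absorbs small changes of the closed-loop matrix.\<close>

lemma stabilizable_neighbourhood: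
  fixes S :: "('n::finite, 'm::finite) sys" and \<alpha> :: real
  assumes "0 < \<alpha>" and "stabilizable \<alpha> S"
  shows "\<exists>U K \<eta> V b. open U \<and> S \<in> U \<and> 0 < \<eta> \<and> \<eta> < \<alpha> \<and> (\<forall>x. norm x \<le> V x \<and> V x \<le> b * norm x) \<and>
    (\<forall>S'\<in>U. \<forall>x. V ((fst S' + snd S' ** K) *v x) \<le> \<eta> * V x)"
proof -
  obtain A B where S: "S = (A, B)" by (cases S)
  obtain K where K: "\<And>l. complex_eigenvalue (A + B ** K) l \<Longrightarrow> norm l < \<alpha>"
    using assms(2) unfolding S stabilizable_def by auto
  define M where "M = A + B ** K"
  obtain \<eta> V b where V: "0 < \<eta>" "\<eta> < \<alpha>" "0 < b" "\<And>x. norm x \<le> V x" "\<And>x. V x \<le> b * norm x"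
    "\<And>x y. V (x + y) \<le> V x + V y" "\<And>x. V (M *v x) \<le> \<eta> * V x - \<eta> / 2 * norm x"
    using exists_contractive_norm[OF assms(1) K] unfolding M_def by metis
  \<comment> \<open>The sum of the absolute entries is continuous in the plant and dominates the
    operator norm. Measuring the error in \<open>V\<close> costs a factor \<open>b\<close>, hence
    the radius \<open>\<eta> / (2 * b)\<close>.\<close>
  define h where "h S' = (\<Sum>i\<in>UNIV. \<Sum>j\<in>UNIV. \<bar>(fst S' + snd S' ** K - M) $ i $ j\<bar>)"
    for S' :: "('n, 'm) sys"
  define U where "U = {S'. h S' < \<eta> / (2 * b)}"
  have "continuous_on UNIV h"
    unfolding h_def matrix_matrix_mult_def by (simp, intro continuous_intros)
  then have "open U" unfolding U_def by (intro open_Collect_less continuous_on_const)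
  moreover have "S \<in> U" using V by (simp add: U_def h_def S M_def)
  moreover have "V ((fst S' + snd S' ** K) *v x) \<le> \<eta> * V x" if "S' \<in> U" for S' x
  proof -
    define E where "E = fst S' + snd S' ** K - M"
    have "norm (E *v x) \<le> onorm ((*v) E) * norm x" by (rule onorm) simp
    also have "\<dots> \<le> h S' * norm x"
      unfolding h_def E_def[symmetric] by (intro mult_right_mono onorm_le_matrix_component_sum) simp
    also have "\<dots> \<le> \<eta> / (2 * b) * norm x"
      using that by (intro mult_right_mono) (auto simp: U_def)
    finally have "b * norm (E *v x) \<le> b * (\<eta> / (2 * b) * norm x)"
      using V(3) by (intro mult_left_mono) auto
    also have "\<dots> = \<eta> / 2 * norm x" using V(3) by simp
    finally have E: "V (E *v x) \<le> \<eta> / 2 * norm x" using V(5)[of "E *v x"] by linarith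
    have "(fst S' + snd S' ** K) *v x = M *v x + E *v x"
      by (simp add: E_def matrix_vector_mult_diff_rdistrib)
    then show ?thesis using V(6)[of "M *v x" "E *v x"] V(7)[of x] E by simp
  qed
  ultimately show ?thesis using V by blast
qed

text \<open>A finite subcover leaves finitely many rates, so the largest of them is still below
  \<open>\<alpha>\<close>.\<close>

lemma finite_stabilizing_family:
  fixes \<Sigma> :: "('n::finite, 'm::finite) sys set" and \<alpha> :: real
  assumes "compact \<Sigma>" "0 < \<alpha>" "\<Sigma> \<subseteq> Sigma_stab \<alpha>"
  obtains N :: nat and K :: "nat \<Rightarrow> real^'n^'m" and V and b \<eta> :: real
  where "0 < \<eta>" "\<eta> < \<alpha>" "1 \<le> b" "\<And>i x. i < N \<Longrightarrow> norm x \<le> V i x" "\<And>i x. i < N \<Longrightarrow> V i x \<le> b * norm x"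
    "\<And>S. S \<in> \<Sigma> \<Longrightarrow> \<exists>i<N. \<forall>x. V i ((fst S + snd S ** K i) *v x) \<le> \<eta> * V i x"
proof -
  have "\<forall>S\<in>\<Sigma>. \<exists>U K \<eta> V b. open U \<and> S \<in> U \<and> 0 < \<eta> \<and> \<eta> < \<alpha> \<and> (\<forall>x. norm x \<le> V x \<and> V x \<le> b * norm x) \<and>
    (\<forall>S'\<in>U. \<forall>x. V ((fst S' + snd S' ** K) *v x) \<le> \<eta> * V x)"
  proof
    fix S assume "S \<in> \<Sigma>"
    then have "stabilizable \<alpha> S" using assms(3) by (auto simp: Sigma_stab_def)
    then show "\<exists>U K \<eta> V b. open U \<and> S \<in> U \<and> 0 < \<eta> \<and> \<eta> < \<alpha> \<and>
        (\<forall>x. norm x \<le> V x \<and> V x \<le> b * norm x) \<and>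
        (\<forall>S'\<in>U. \<forall>x. V ((fst S' + snd S' ** K) *v x) \<le> \<eta> * V x)"
      by (rule stabilizable_neighbourhood[OF assms(2)])
  qed
  then obtain U K \<eta> V b where "\<forall>S\<in>\<Sigma>. open (U S) \<and> S \<in> U S \<and> 0 < \<eta> S \<and> \<eta> S < \<alpha> \<and>
    (\<forall>x. norm x \<le> V S x \<and> V S x \<le> b S * norm x) \<and>
    (\<forall>S'\<in>U S. \<forall>x. V S ((fst S' + snd S' ** K S) *v x) \<le> \<eta> S * V S x)"
    unfolding bchoice_iff by (elim exE)
  then have loc: "\<And>S. S \<in> \<Sigma> \<Longrightarrow> open (U S) \<and> S \<in> U S \<and> 0 < \<eta> S \<and> \<eta> S < \<alpha> \<and>
    (\<forall>x. norm x \<le> V S x \<and> V S x \<le> b S * norm x) \<and>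
    (\<forall>S'\<in>U S. \<forall>x. V S ((fst S' + snd S' ** K S) *v x) \<le> \<eta> S * V S x)" by (rule bspec)
  obtain C where C: "C \<subseteq> \<Sigma>" "finite C" "\<Sigma> \<subseteq> (\<Union>S\<in>C. U S)"
    using compactE_image[OF assms(1), of \<Sigma> U] loc by blast
  obtain xs where xs: "set xs = C" using finite_list[OF C(2)] by blast
  \<comment> \<open>The inserted elements \<open>\<alpha> / 2\<close> and 1 keep the maxima
    meaningful for empty \<open>C\<close> and ensure \<open>0 < \<eta>0\<close> and
    \<open>1 \<le> b0\<close>.\<close>
  define \<eta>0 where "\<eta>0 = Max (insert (\<alpha> / 2) (\<eta> ` C))"
  define b0 where "b0 = Max (insert 1 (b ` C))"
  have mem: "xs ! i \<in> C" "xs ! i \<in> \<Sigma>" if "i < length xs" for i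
    using that xs C(1) by auto
  show thesis
  proof (rule that[of \<eta>0 b0 "length xs" "\<lambda>i. V (xs ! i)" "\<lambda>i. K (xs ! i)"])
    show "\<eta>0 < \<alpha>" unfolding \<eta>0_def using C loc assms(2) by (subst Max_less_iff) auto
    have "\<alpha> / 2 \<le> \<eta>0" unfolding \<eta>0_def using C by (intro Max_ge) auto
    then show "0 < \<eta>0" using assms(2) by simp
    show "1 \<le> b0" unfolding b0_def using C by (intro Max_ge) auto
    fix i x assume i: "i < length xs"
    show "norm x \<le> V (xs ! i) x" using loc mem[OF i] by blast
    have "b (xs ! i) \<le> b0" unfolding b0_def using C mem[OF i] by (intro Max_ge) auto
    then have "b (xs ! i) * norm x \<le> b0 * norm x" by (intro mult_right_mono) auto
    then show "V (xs ! i) x \<le> b0 * norm x" using loc mem[OF i] order_trans by blast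
  next
    fix S assume "S \<in> \<Sigma>"
    then obtain S0 where S0: "S0 \<in> C" "S \<in> U S0" using C by blast
    then obtain i where i: "i < length xs" "xs ! i = S0" using xs by (metis in_set_conv_nth)
    have "V S0 ((fst S + snd S ** K S0) *v x) \<le> \<eta>0 * V S0 x" for x
    proof -
      have "\<eta> S0 \<le> \<eta>0" unfolding \<eta>0_def using C S0 by (intro Max_ge) auto
      moreover have "0 \<le> V S0 x"
        using loc[of S0] S0(1) C(1) norm_ge_zero[of x] order_trans by blast
      ultimately have "\<eta> S0 * V S0 x \<le> \<eta>0 * V S0 x" by (rule mult_right_mono)
      then show ?thesis using loc[of S0] S0 C(1) order_trans by blast
    qed
    then show "\<exists>i<length xs. \<forall>x. V (xs ! i) ((fst S + snd S ** K (xs ! i)) *v x) \<le> \<eta>0 * V (xs ! i) x"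
      using i by blast
  qed
qed

section \<open>The switching controller\<close>

text \<open>Bounds the growth also under gains that do not suit the plant, and thus the cost of a
  switch.\<close>

lemma matrix_family_bounded:
  fixes \<Sigma> :: "('n::finite, 'm::finite) sys set" and K :: "nat \<Rightarrow> real^'n^'m"
  assumes "compact \<Sigma>"
  obtains L where "0 \<le> L"
    "\<And>S i x. S \<in> \<Sigma> \<Longrightarrow> i < N \<Longrightarrow> norm ((fst S + snd S ** K i) *v x) \<le> L * norm x"
proof -
  define h where "h S = (\<Sum>i<N. \<Sum>j\<in>UNIV. \<Sum>k\<in>UNIV. \<bar>(fst S + snd S ** K i) $ j $ k\<bar>)"
    for S :: "('n, 'm) sys"
  have "continuous_on \<Sigma> h"
    unfolding h_def matrix_matrix_mult_def by (simp, intro continuous_intros)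
  then have "bounded (h ` \<Sigma>)"
    using assms compact_continuous_image compact_imp_bounded by blast
  then obtain L where L: "\<And>S. S \<in> \<Sigma> \<Longrightarrow> norm (h S) \<le> L"
    by (auto simp: bounded_iff)
  show thesis
  proof (rule that[of "max 0 L"])
    fix S i x assume S: "S \<in> \<Sigma>" and i: "i < N"
    have "norm ((fst S + snd S ** K i) *v x) \<le> onorm ((*v) (fst S + snd S ** K i)) * norm x"
      by (rule onorm) simp
    also have "\<dots> \<le> (\<Sum>j\<in>UNIV. \<Sum>k\<in>UNIV. \<bar>(fst S + snd S ** K i) $ j $ k\<bar>) * norm x"
      by (intro mult_right_mono onorm_le_matrix_component_sum) simp
    also have "\<dots> \<le> h S * norm x"
      unfolding h_def using i
      by (intro mult_right_mono member_le_sum[where f = "\<lambda>i. \<Sum>j\<in>UNIV. \<Sum>k\<in>UNIV. \<bar>(fst S + snd S ** K i) $ j $ k\<bar>"])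
        (auto intro!: sum_nonneg)
    also have "\<dots> \<le> max 0 L * norm x"
      using L[OF S] by (intro mult_right_mono) auto
    finally show "norm ((fst S + snd S ** K i) *v x) \<le> max 0 L * norm x" .
  qed simp
qed

section \<open>Switching rule and cyclic order of the modes\<close>

definition next_mode :: "nat \<Rightarrow> nat \<Rightarrow> nat" where
  "next_mode N i = (if Suc i < N then Suc i else 0)"

text \<open>The controller state holds the current mode in entry \<open>0\<close> and, in entry \<open>1\<close>, the largest
  value of \<open>V i\<close> at the next state that is compatible with mode \<open>i\<close> being stabilizing. A mode
  whose prediction fails is abandoned. The initial controller state may be arbitrary, so entry \<open>0\<close>
  need not be the number of a mode.\<close>

definition active_mode ::
  "nat \<Rightarrow> (nat \<Rightarrow> real^'n \<Rightarrow> real) \<Rightarrow> real^'n \<Rightarrow> (nat \<Rightarrow> real) \<Rightarrow> nat" where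
  "active_mode N V x z =
    (let i = (if nat \<lfloor>z 0\<rfloor> < N then nat \<lfloor>z 0\<rfloor> else 0)
     in if V i x \<le> z 1 then i else next_mode N i)"

definition switching_update ::
  "nat \<Rightarrow> (nat \<Rightarrow> real^'n \<Rightarrow> real) \<Rightarrow> real \<Rightarrow> real^'n \<Rightarrow> (nat \<Rightarrow> real) \<Rightarrow> nat \<Rightarrow> real" where
  "switching_update N V \<eta> x z =
    (\<lambda>_. 0)(0 := real (active_mode N V x z), 1 := \<eta> * V (active_mode N V x z) x)"

definition switching_feedback ::
  "nat \<Rightarrow> (nat \<Rightarrow> real^'n \<Rightarrow> real) \<Rightarrow> (nat \<Rightarrow> real^'n^'m) \<Rightarrow> real^'n \<Rightarrow> (nat \<Rightarrow> real) \<Rightarrow> real^'m" where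
  "switching_feedback N V K x z = K (active_mode N V x z) *v x"

text \<open>Cyclic distance: for modes below \<open>N\<close>, the number of applications of
  \<open>next_mode\<close> that lead from \<open>i\<close> to \<open>s\<close>.\<close>

definition switches_left :: "nat \<Rightarrow> nat \<Rightarrow> nat \<Rightarrow> nat" where
  "switches_left N s i = (if i \<le> s then s - i else s + N - i)"

lemma switches_left_next_mode:
  "s < N \<Longrightarrow> i < N \<Longrightarrow> i \<noteq> s \<Longrightarrow> switches_left N s i = Suc (switches_left N s (next_mode N i))"
  by (auto simp: switches_left_def next_mode_def)

lemma switches_left_le: "s < N \<Longrightarrow> i < N \<Longrightarrow> switches_left N s i \<le> N"
  by (auto simp: switches_left_def)

lemma active_mode_less: "0 < N \<Longrightarrow> active_mode N V x z < N"
  by (auto simp: active_mode_def next_mode_def Let_def)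

text \<open>After an update the stored mode is valid and decoded exactly, so the fallback to mode 0
  cannot occur, and the stored bound is the prediction of the mode just used.\<close>

lemma active_mode_switching_update:
  "0 < N \<Longrightarrow> active_mode N V x' (switching_update N V \<eta> x z) =
    (let i = active_mode N V x z in if V i x' \<le> \<eta> * V i x then i else next_mode N i)"
  by (subst active_mode_def) (simp add: switching_update_def active_mode_less)

text \<open>Analysis for one plant \<open>S\<close> and a mode \<open>s\<close> that suits it. The
  controller is built from \<open>N\<close>, \<open>V\<close>, \<open>\<eta>\<close> and
  \<open>K\<close>, without knowledge of \<open>S\<close> or \<open>s\<close>.\<close>

locale switching_control =
  fixes S :: "('n::finite, 'm::finite) sys" and N :: nat and K :: "nat \<Rightarrow> real^'n^'m"
    and V :: "nat \<Rightarrow> real^'n \<Rightarrow> real" and b \<eta> L :: real and s :: nat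
  assumes \<eta>: "0 < \<eta>" and b: "1 \<le> b" and L: "0 \<le> L"
    and V_ge: "i < N \<Longrightarrow> norm x \<le> V i x" and V_le: "i < N \<Longrightarrow> V i x \<le> b * norm x"
    and growth: "i < N \<Longrightarrow> norm ((fst S + snd S ** K i) *v x) \<le> L * norm x"
    and s: "s < N" and contr: "V s ((fst S + snd S ** K s) *v x) \<le> \<eta> * V s x"
begin

text \<open>Comparing two of the norms costs \<open>b\<close>, one time step costs \<open>L\<close>,
  and the desired rate is \<open>\<eta>\<close>. The maximum with 1 makes the powers of
  \<open>R\<close> nondecreasing.\<close>

definition R where "R = max 1 (b * L / \<eta>)"

text \<open>Lyapunov function of the switched loop: each switch that is still possible is charged a
  factor \<open>R\<close> in advance.\<close>

definition W where "W i x = R ^ switches_left N s i * V i x"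

lemma R_ge_1: "1 \<le> R" by (simp add: R_def)

lemma V_nonneg: "i < N \<Longrightarrow> 0 \<le> V i x"
  using V_ge[of i x] norm_ge_zero[of x] by linarith

lemma V_le_W: "i < N \<Longrightarrow> V i x \<le> W i x"
  unfolding W_def using mult_right_mono[OF one_le_power[OF R_ge_1] V_nonneg] by simp

lemma W_le: "i < N \<Longrightarrow> W i x \<le> R ^ N * b * norm x"
proof -
  assume i: "i < N"
  have "W i x \<le> R ^ N * V i x"
    unfolding W_def using R_ge_1 i s
    by (intro mult_right_mono power_increasing switches_left_le V_nonneg)
  also have "\<dots> \<le> R ^ N * (b * norm x)"
    using R_ge_1 V_le[OF i] by (intro mult_left_mono) auto
  finally show ?thesis by (simp add: mult.assoc)
qed

text \<open>A switch costs at most the factor \<open>R * \<eta>\<close> in \<open>V\<close>, and it is paid for by the factor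
  \<open>R\<close> that \<open>W\<close> loses with the number of switches left.\<close>

lemma W_step:
  fixes x
  assumes i: "i < N"
  defines "x' \<equiv> (fst S + snd S ** K i) *v x"
  shows "W (if V i x' \<le> \<eta> * V i x then i else next_mode N i) x' \<le> \<eta> * W i x"
proof (cases "V i x' \<le> \<eta> * V i x")
  case True
  then have "R ^ switches_left N s i * V i x' \<le> R ^ switches_left N s i * (\<eta> * V i x)"
    using R_ge_1 by (intro mult_left_mono) auto
  then show ?thesis using True by (simp add: W_def mult.left_commute)
next
  case False
  \<comment> \<open>The prediction of mode \<open>s\<close> never fails.\<close>
  then have "i \<noteq> s" using contr[of x] by (auto simp: x'_def)
  define j where "j = next_mode N i"
  have j: "j < N" using i by (auto simp: j_def next_mode_def)
  have "V j x' \<le> b * norm x'" by (rule V_le[OF j])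
  also have "\<dots> \<le> b * (L * norm x)"
    unfolding x'_def using b growth[OF i] by (intro mult_left_mono) auto
  also have "\<dots> \<le> b * (L * V i x)"
    using b L V_ge[OF i] by (intro mult_left_mono) auto
  also have "\<dots> = (b * L / \<eta>) * (\<eta> * V i x)" using \<eta> by simp
  also have "\<dots> \<le> R * (\<eta> * V i x)"
    using \<eta> V_nonneg[OF i] by (intro mult_right_mono) (auto simp: R_def)
  finally have "R ^ switches_left N s j * V j x' \<le> R ^ switches_left N s j * (R * (\<eta> * V i x))"
    using R_ge_1 by (intro mult_left_mono) auto
  then show ?thesis
    using False switches_left_next_mode[OF s i \<open>i \<noteq> s\<close>]
    by (simp add: W_def j_def[symmetric] mult_ac)
qed

lemma closed_loop_decay:
  fixes x0 z0
  defines "x \<equiv> xsol S (switching_update N V \<eta>) (switching_feedback N V K) x0 z0"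
    and "z \<equiv> zsol S (switching_update N V \<eta>) (switching_feedback N V K) x0 z0"
  shows "W (active_mode N V (x t) (z t)) (x t) \<le> \<eta> ^ t * (R ^ N * b * norm x0)"
proof (induction t)
  case 0
  \<comment> \<open>The initial controller state may select any mode; the bound of
    \<open>W_le\<close> holds for all of them.\<close>
  show ?case using W_le[OF active_mode_less] s by (simp add: x_def xsol_def)
next
  case (Suc t)
  have "0 < N" using s by simp
  define i where "i = active_mode N V (x t) (z t)"
  have i: "i < N" using \<open>0 < N\<close> by (simp add: i_def active_mode_less)
  have x: "x (Suc t) = (fst S + snd S ** K i) *v x t"
    by (simp add: x_def z_def xsol_def zsol_def split_beta i_def switching_feedback_def
        matrix_vector_mul_assoc matrix_vector_mult_add_rdistrib)
  have z: "z (Suc t) = switching_update N V \<eta> (x t) (z t)"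
    by (simp add: x_def z_def xsol_def zsol_def split_beta)
  have "W (active_mode N V (x (Suc t)) (z (Suc t))) (x (Suc t)) \<le> \<eta> * W i (x t)"
    unfolding z active_mode_switching_update[OF \<open>0 < N\<close>] i_def[symmetric] Let_def x
    by (rule W_step[OF i])
  also have "\<dots> \<le> \<eta> * (\<eta> ^ t * (R ^ N * b * norm x0))"
    using Suc \<eta> by (intro mult_left_mono) (auto simp: i_def)
  finally show ?case by (simp add: mult.assoc)
qed

lemma norm_xsol_le:
  "norm (xsol S (switching_update N V \<eta>) (switching_feedback N V K) x0 z0 t)
    \<le> (R ^ N * b) * \<eta> ^ t * norm x0"
proof -
  let ?x = "xsol S (switching_update N V \<eta>) (switching_feedback N V K) x0 z0"
  let ?i = "active_mode N V (?x t) (zsol S (switching_update N V \<eta>) (switching_feedback N V K) x0 z0 t)"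
  have "?i < N" using s by (simp add: active_mode_less)
  then have "norm (?x t) \<le> W ?i (?x t)" using V_ge V_le_W order_trans by blast
  also have "\<dots> \<le> \<eta> ^ t * (R ^ N * b * norm x0)" by (rule closed_loop_decay)
  finally show ?thesis by (simp add: mult_ac)
qed

text \<open>After time 0, entry 0 is a mode number below \<open>N\<close> and entry 1 is controlled
  by the decay of \<open>W\<close>. At time 0 the state is arbitrary, hence the maximum with the
  size of \<open>z0\<close> in the bound.\<close>

lemma zsol_bounded:
  assumes "\<eta> \<le> 1"
  shows "\<exists>M. \<forall>t. L2_set (zsol S (switching_update N V \<eta>) (switching_feedback N V K) x0 z0 t) {..<2} \<le> M"
proof -
  let ?x = "xsol S (switching_update N V \<eta>) (switching_feedback N V K) x0 z0"
  let ?z = "zsol S (switching_update N V \<eta>) (switching_feedback N V K) x0 z0"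
  let ?M = "real N + R ^ N * b * norm x0"
  have nonneg: "0 \<le> R ^ N * b * norm x0" using R_ge_1 b by simp
  have "L2_set (?z t) {..<2} \<le> max (L2_set z0 {..<2}) ?M" for t
  proof (cases t)
    case 0
    then show ?thesis by (simp add: zsol_def)
  next
    case (Suc u)
    define i where "i = active_mode N V (?x u) (?z u)"
    have i: "i < N" using s by (simp add: i_def active_mode_less)
    have z: "?z t = switching_update N V \<eta> (?x u) (?z u)"
      by (simp add: Suc xsol_def zsol_def split_beta)
    have "\<eta> * V i (?x u) \<le> 1 * W i (?x u)"
      using assms \<eta> V_le_W[OF i] V_nonneg[OF i] by (intro mult_mono) auto
    also have "\<dots> \<le> \<eta> ^ u * (R ^ N * b * norm x0)"
      using closed_loop_decay[of x0 z0 u] by (simp add: i_def)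
    also have "\<dots> \<le> 1 * (R ^ N * b * norm x0)"
      using \<eta> assms nonneg by (intro mult_right_mono power_le_one) auto
    finally have V: "\<eta> * V i (?x u) \<le> R ^ N * b * norm x0" by simp
    have "L2_set (?z t) {..<2} \<le> (\<Sum>k<2. \<bar>?z t k\<bar>)" by (rule L2_set_le_sum_abs)
    also have "\<dots> = real i + \<eta> * V i (?x u)"
      using \<eta> V_nonneg[OF i] by (simp add: z switching_update_def i_def numeral_2_eq_2)
    also have "\<dots> \<le> ?M" using V i by simp
    finally show ?thesis by simp
  qed
  then show ?thesis by blast
qed

end

lemma switching_update_in_Rspace: "switching_update N V \<eta> x z \<in> Rspace 2"
  by (simp add: Rspace_def topspace_Euclidean_space switching_update_def)

theorem enables_robust_exp_stabilization_if_stabilizable: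
  fixes \<Sigma> :: "('n::finite, 'm::finite) sys set" and \<alpha> :: real
  assumes "compact \<Sigma>" "0 < \<alpha>" "\<alpha> \<le> 1" "\<Sigma> \<subseteq> Sigma_stab \<alpha>"
  shows "enables_robust_exp_stabilization \<alpha> \<Sigma>"
proof -
  from finite_stabilizing_family[OF assms(1,2,4)]
  obtain N :: nat and K :: "nat \<Rightarrow> real^'n^'m" and V and b \<eta> :: real
    where fam: "0 < \<eta>" "\<eta> < \<alpha>" "1 \<le> b" "\<And>i x. i < N \<Longrightarrow> norm x \<le> V i x"
      "\<And>i x. i < N \<Longrightarrow> V i x \<le> b * norm x"
      "\<And>S. S \<in> \<Sigma> \<Longrightarrow> \<exists>i<N. \<forall>x. V i ((fst S + snd S ** K i) *v x) \<le> \<eta> * V i x"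
    by metis
  obtain L where L: "0 \<le> L"
    "\<And>S i x. S \<in> \<Sigma> \<Longrightarrow> i < N \<Longrightarrow> norm ((fst S + snd S ** K i) *v x) \<le> L * norm x"
    using matrix_family_bounded[OF assms(1)] by metis
  have ctrl: "\<exists>s. switching_control S N K V b \<eta> L s" if S: "S \<in> \<Sigma>" for S
  proof -
    obtain s where "s < N" "\<And>x. V s ((fst S + snd S ** K s) *v x) \<le> \<eta> * V s x"
      using fam(6)[OF S] by blast
    then have "switching_control S N K V b \<eta> L s"
      using fam L S by unfold_locales auto
    then show ?thesis ..
  qed
  let ?f = "switching_update N V \<eta>" and ?g = "switching_feedback N V K"
  \<comment> \<open>This is \<open>R ^ N * b\<close> of the locale. It depends on neither the plant
    nor \<open>s\<close>, so the bound is uniform over the plants.\<close>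
  define c where "c = max 1 (b * L / \<eta>) ^ N * b"
  have "1 \<le> c"
    unfolding c_def using mult_mono[of 1 "max 1 (b * L / \<eta>) ^ N" 1 b] fam(3) one_le_power[of "max 1 (b * L / \<eta>)" N]
    by simp
  show ?thesis
    unfolding enables_robust_exp_stabilization_def
  proof (intro exI[of _ "2::nat"] exI[of _ ?f] exI[of _ ?g] exI[of _ c] conjI bexI[of _ \<eta>] ballI allI)
    show "bounded_z 2 \<Sigma> ?f ?g"
      unfolding bounded_z_def
    proof (intro allI ballI)
      fix x0 :: "real^'n" and z0 S assume "S \<in> \<Sigma>"
      then obtain s where "switching_control S N K V b \<eta> L s" using ctrl by blast
      from switching_control.zsol_bounded[OF this]
      show "\<exists>M. \<forall>t. L2_set (zsol S ?f ?g x0 z0 t) {..<2} \<le> M"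
        using fam(2) assms(3) by auto
    qed
    fix x0 :: "real^'n" and z0 S t assume "S \<in> \<Sigma>"
    then obtain s where sc: "switching_control S N K V b \<eta> L s" using ctrl by blast
    show "norm (xsol S ?f ?g x0 z0 t) \<le> c * \<eta> ^ t * norm x0"
      using switching_control.norm_xsol_le[OF sc, of x0 z0 t]
      unfolding c_def switching_control.R_def[OF sc] .
  qed (use fam \<open>1 \<le> c\<close> in \<open>auto simp: switching_update_in_Rspace\<close>)
qed

section \<open>Gains from trajectories\<close>

text \<open>\<open>N - mat l\<close> and its transpose have the same determinant.\<close>

lemma exists_left_eigenvector:
  fixes N :: "'a::field^'n^'n"
  assumes "v \<noteq> 0" "N *v v = l *s v"
  shows "\<exists>w. w \<noteq> 0 \<and> transpose N *v w = l *s w"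
proof -
  have mat: "mat l *v x = l *s x" for x :: "'a^'n"
    by (simp add: vec_eq_iff matrix_vector_mult_def mat_def if_distrib[where f = "\<lambda>a. a * b" for b] cong: if_cong)
  have singular: "det P = 0 \<longleftrightarrow> (\<exists>x. x \<noteq> 0 \<and> P *v x = 0)" for P :: "'a^'n^'n"
    using matrix_left_invertible_ker[of P] invertible_left_inverse[of P] invertible_det_nz[of P] by blast
  have "(N - mat l) *v v = 0"
    using assms by (simp add: matrix_vector_mult_diff_rdistrib mat)
  then have "det (N - mat l) = 0" using singular assms(1) by blast
  then have "det (transpose (N - mat l)) = 0" by simp
  also have "transpose (N - mat l) = transpose N - mat l"
    by (auto simp: vec_eq_iff transpose_def mat_def)
  finally obtain w where "w \<noteq> 0" "(transpose N - mat l) *v w = 0" using singular by blast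
  then show ?thesis by (auto simp: matrix_vector_mult_diff_rdistrib mat)
qed

text \<open>Pythagoras: orthogonality removes the mixed terms.\<close>

lemma sum_norm_power2_le_orthogonal:
  fixes a c :: "'p \<Rightarrow> complex"
  assumes "(\<Sum>p\<in>P. cnj (a p) * c p) = 0"
  shows "(\<Sum>p\<in>P. (norm (a p))\<^sup>2) \<le> (\<Sum>p\<in>P. (norm (a p + c p))\<^sup>2)"
proof -
  have eq: "(norm (a p + c p))\<^sup>2 = (norm (a p))\<^sup>2 + (norm (c p))\<^sup>2 + 2 * Re (cnj (a p) * c p)" for p
    unfolding cmod_power2 by (simp add: power2_eq_square algebra_simps)
  have "(\<Sum>p\<in>P. Re (cnj (a p) * c p)) = 0"
    using assms by (metis Re_sum zero_complex.sel(1))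
  then have "(\<Sum>p\<in>P. (norm (a p + c p))\<^sup>2) = (\<Sum>p\<in>P. (norm (a p))\<^sup>2) + (\<Sum>p\<in>P. (norm (c p))\<^sup>2)"
    unfolding eq by (simp add: sum.distrib sum_distrib_left[symmetric])
  then show ?thesis by (simp add: sum_nonneg)
qed

text \<open>\<open>K\<close> is the least-squares solution of \<open>v p = K y p\<close>, so the residuals are orthogonal to the
  data. The covariance matrix \<open>X\<close> of the data is invertible since the data span the space.\<close>

lemma exists_least_squares_gain:
  fixes y :: "'p \<Rightarrow> real^'n" and v :: "'p \<Rightarrow> real^'m"
  assumes "finite P" and spans: "\<And>w. (\<And>p. p \<in> P \<Longrightarrow> y p \<bullet> w = 0) \<Longrightarrow> w = 0"
  shows "\<exists>K :: real^'n^'m. \<forall>j k. (\<Sum>p\<in>P. y p $ k * (v p - K *v y p) $ j) = 0"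
proof -
  define X :: "real^'n^'n" where "X = (\<chi> j k. \<Sum>p\<in>P. y p $ j * y p $ k)"
  define G :: "real^'n^'m" where "G = (\<chi> j k. \<Sum>p\<in>P. v p $ j * y p $ k)"
  have "w = 0" if "X *v w = 0" for w
  proof -
    have "X *v w = (\<Sum>p\<in>P. (y p \<bullet> w) *\<^sub>R y p)"
    proof (subst vec_eq_iff, intro allI)
      fix j
      have "(X *v w) $ j = (\<Sum>k\<in>UNIV. \<Sum>p\<in>P. y p $ j * y p $ k * w $ k)"
        by (simp add: X_def matrix_vector_mult_def sum_distrib_right)
      also have "\<dots> = (\<Sum>p\<in>P. \<Sum>k\<in>UNIV. y p $ j * y p $ k * w $ k)"
        by (rule sum.swap)
      also have "\<dots> = (\<Sum>p\<in>P. (y p \<bullet> w) *\<^sub>R y p) $ j"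
        by (simp add: inner_vec_def sum_distrib_right sum_distrib_left mult_ac)
      finally show "(X *v w) $ j = (\<Sum>p\<in>P. (y p \<bullet> w) *\<^sub>R y p) $ j" .
    qed
    \<comment> \<open>Pairing \<open>X *v w\<close> with \<open>w\<close> gives a sum of squares, so
      every \<open>y p \<bullet> w\<close> vanishes.\<close>
    then have "(\<Sum>p\<in>P. (y p \<bullet> w) *\<^sub>R y p) \<bullet> w = 0" using that by simp
    then have "(\<Sum>p\<in>P. (y p \<bullet> w)\<^sup>2) = 0"
      by (simp add: inner_sum_left power2_eq_square)
    then have "\<forall>p\<in>P. (y p \<bullet> w)\<^sup>2 = 0"
      using assms(1) by (subst (asm) sum_nonneg_eq_0_iff) auto
    then show "w = 0" by (intro spans) auto
  qed
  then obtain X' where X': "X' ** X = mat 1"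
    using matrix_left_invertible_ker[of X] by blast
  \<comment> \<open>\<open>K ** X = G\<close> are the normal equations; read entrywise they are the
    claimed orthogonality relations.\<close>
  define K where "K = G ** X'"
  have "K ** X = G"
    unfolding K_def by (simp add: matrix_mul_assoc[symmetric] X')
  have "(\<Sum>p\<in>P. y p $ k * (v p - K *v y p) $ j) = 0" for j k
  proof -
    have "(\<Sum>p\<in>P. y p $ k * (K *v y p) $ j) = (\<Sum>p\<in>P. \<Sum>l\<in>UNIV. y p $ k * (K $ j $ l * y p $ l))"
      by (simp add: matrix_vector_mult_def sum_distrib_left)
    also have "\<dots> = (\<Sum>l\<in>UNIV. \<Sum>p\<in>P. y p $ k * (K $ j $ l * y p $ l))"
      by (rule sum.swap)
    also have "\<dots> = (K ** X) $ j $ k"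
      by (simp add: matrix_matrix_mult_def X_def sum_distrib_left mult_ac)
    also have "\<dots> = (\<Sum>p\<in>P. y p $ k * v p $ j)"
      unfolding \<open>K ** X = G\<close> by (simp add: G_def mult.commute)
    finally show ?thesis by (simp add: right_diff_distrib sum_subtractf)
  qed
  then show ?thesis by blast
qed

text \<open>The pairing is bilinear, without conjugation, so that a left eigenvector turns the
  matrix into the factor \<open>l\<close> and not its conjugate.\<close>

definition cfun :: "complex^'n \<Rightarrow> real^'n \<Rightarrow> complex" where
  "cfun w x = (\<Sum>j\<in>UNIV. w $ j * of_real (x $ j))"

lemma cfun_add: "cfun w (x + y) = cfun w x + cfun w y"
  by (simp add: cfun_def distrib_left sum.distrib)

lemma cfun_scaleR: "cfun w (c *\<^sub>R x) = of_real c * cfun w x"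
  by (simp add: cfun_def sum_distrib_left mult.left_commute)

lemma cfun_axis: "cfun w (axis i 1) = w $ i"
  by (simp add: cfun_def axis_def if_distrib cong: if_cong)

lemma cfun_matrix:
  "cfun w (M *v x) = cfun (transpose (map_matrix of_real M) *v w) x"
proof -
  have "cfun w (M *v x) = (\<Sum>j\<in>UNIV. \<Sum>k\<in>UNIV. w $ j * (of_real (M $ j $ k) * of_real (x $ k)))"
    by (simp add: cfun_def matrix_vector_mult_def sum_distrib_left)
  also have "\<dots> = (\<Sum>k\<in>UNIV. \<Sum>j\<in>UNIV. w $ j * (of_real (M $ j $ k) * of_real (x $ k)))"
    by (rule sum.swap)
  also have "\<dots> = cfun (transpose (map_matrix of_real M) *v w) x"
    unfolding cfun_def matrix_vector_mult_def transpose_def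
    by (simp add: sum_distrib_right) (simp add: mult_ac)
  finally show ?thesis .
qed

lemma cfun_scale: "cfun (l *s w) x = l * cfun w x"
  by (simp add: cfun_def sum_distrib_left mult.assoc)

lemma norm_power2_vec: "(norm w)\<^sup>2 = (\<Sum>i\<in>UNIV. (norm (w $ i))\<^sup>2)" for w :: "complex^'n"
  by (simp add: norm_vec_def L2_set_def sum_nonneg)

lemma norm_cfun_le: "norm (cfun w x) \<le> norm w * norm x"
proof -
  have "norm (cfun w x) \<le> (\<Sum>j\<in>UNIV. \<bar>norm (w $ j)\<bar> * \<bar>norm (x $ j)\<bar>)"
    unfolding cfun_def by (rule order_trans[OF norm_sum]) (simp add: norm_mult)
  also have "\<dots> \<le> norm w * norm x"
    unfolding norm_vec_def by (rule L2_set_mult_ineq)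
  finally show ?thesis .
qed

text \<open>Orthogonality in real coordinates extends to complex functionals, because the sum is
  sesquilinear in \<open>w\<close> and \<open>u\<close>.\<close>

lemma sum_cnj_cfun_eq_0:
  assumes "\<And>j k. (\<Sum>p\<in>P. y p $ k * r p $ j) = 0"
  shows "(\<Sum>p\<in>P. cnj (cfun w (y p)) * cfun u (r p)) = 0"
proof -
  have "(\<Sum>p\<in>P. cnj (cfun w (y p)) * cfun u (r p))
      = (\<Sum>p\<in>P. \<Sum>k\<in>UNIV. \<Sum>j\<in>UNIV. cnj (w $ k) * u $ j * of_real (y p $ k * r p $ j))"
    unfolding cfun_def cnj_sum sum_product by (simp add: mult_ac)
  also have "\<dots> = (\<Sum>k\<in>UNIV. \<Sum>p\<in>P. \<Sum>j\<in>UNIV. cnj (w $ k) * u $ j * of_real (y p $ k * r p $ j))"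
    by (rule sum.swap)
  also have "\<dots> = (\<Sum>k\<in>UNIV. \<Sum>j\<in>UNIV. \<Sum>p\<in>P. cnj (w $ k) * u $ j * of_real (y p $ k * r p $ j))"
    by (intro sum.cong sum.swap refl)
  also have "\<dots> = (\<Sum>k\<in>UNIV. \<Sum>j\<in>UNIV. cnj (w $ k) * u $ j * of_real (\<Sum>p\<in>P. y p $ k * r p $ j))"
    by (simp add: sum_distrib_left)
  finally show ?thesis by (simp add: assms)
qed

text \<open>Take finite pieces of scaled trajectories starting at the unit vectors and ending close to
  \<open>0\<close>, and let \<open>K\<close> be the least-squares gain for these data. For a left eigenvector \<open>w\<close> of
  \<open>A + B ** K\<close> with eigenvalue \<open>l\<close>, orthogonality of the residuals shows that the energy \<open>q\<close> of
  the data in the direction \<open>w\<close> is multiplied by at least \<open>(norm l / \<alpha>)\<^sup>2\<close> in one time step,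
  while it actually decreases: the initial unit vectors are replaced by the small end points.\<close>

theorem stabilizable_if_asymptotically_controllable:
  fixes A :: "real^'n::finite^'n" and B :: "real^'m::finite^'n"
  assumes \<alpha>: "0 < \<alpha>"
    and ctrl: "\<And>x0. \<exists>x u. x 0 = x0 \<and> (\<forall>t. x (Suc t) = A *v x t + B *v u t) \<and>
      (\<lambda>t. norm (x t) / \<alpha> ^ t) \<longlonglongrightarrow> 0"
  shows "stabilizable \<alpha> (A, B)"
proof -
  have "\<forall>i::'n. \<exists>x u. x 0 = axis i 1 \<and> (\<forall>t. x (Suc t) = A *v x t + B *v u t) \<and>
      (\<lambda>t. norm (x t) / \<alpha> ^ t) \<longlonglongrightarrow> 0"
    using ctrl by (intro allI)
  then obtain x u where "\<forall>i::'n. x i 0 = axis i 1 \<and> (\<forall>t. x i (Suc t) = A *v x i t + B *v u i t) \<and>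
      (\<lambda>t. norm (x i t) / \<alpha> ^ t) \<longlonglongrightarrow> 0"
    unfolding choice_iff by (elim exE)
  then have x0: "\<And>i. x i 0 = axis i 1"
    and xu: "\<And>i t. x i (Suc t) = A *v x i t + B *v u i t"
    and lim: "\<And>i. (\<lambda>t. norm (x i t) / \<alpha> ^ t) \<longlonglongrightarrow> 0"
    by blast+
  \<comment> \<open>The scaling turns decay faster than \<open>\<alpha> ^ t\<close> into convergence
    to 0 and puts a factor \<open>\<alpha>\<close> into the recursion.\<close>
  define y where "y i t = (1 / \<alpha> ^ t) *\<^sub>R x i t" for i t
  define v where "v i t = (1 / \<alpha> ^ t) *\<^sub>R u i t" for i t
  have y0: "y i 0 = axis i 1" for i by (simp add: y_def x0)
  have yv: "A *v y i t + B *v v i t = \<alpha> *\<^sub>R y i (Suc t)" for i t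
    using \<alpha> by (simp add: y_def v_def xu matrix_vector_mult_scaleR scaleR_add_right)
  have "(\<lambda>t. norm (y i t)) \<longlonglongrightarrow> 0" for i
    using lim[of i] \<alpha> by (simp add: y_def)
  then have "(\<lambda>t. \<Sum>i\<in>UNIV. (norm (y i t))\<^sup>2) \<longlonglongrightarrow> (\<Sum>i\<in>(UNIV::'n set). 0\<^sup>2)"
    by (intro tendsto_sum tendsto_power)
  then have "eventually (\<lambda>t. (\<Sum>i\<in>UNIV. (norm (y i t))\<^sup>2) < 1) sequentially"
    by (rule order_tendstoD(2)) simp
  \<comment> \<open>At time \<open>T\<close> the end points are small in total;
    \<open>1 \<le> T\<close> puts the unit vectors \<open>y i 0\<close> among the data, which
    therefore span the space.\<close>
  from eventually_conj[OF this eventually_ge_at_top[of 1]]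
  obtain T where T: "(\<Sum>i\<in>UNIV. (norm (y i T))\<^sup>2) < 1" "1 \<le> T"
    by (auto dest: eventually_happens)
  define P where "P = (UNIV :: 'n set) \<times> {..<T}"
  have "\<exists>K :: real^'n^'m. \<forall>j k. (\<Sum>p\<in>P. y (fst p) (snd p) $ k *
      (v (fst p) (snd p) - K *v y (fst p) (snd p)) $ j) = 0"
  proof (rule exists_least_squares_gain)
    show "finite P" by (simp add: P_def)
    show "w = 0" if orth: "\<And>p. p \<in> P \<Longrightarrow> y (fst p) (snd p) \<bullet> w = 0" for w
    proof (subst vec_eq_iff, intro allI)
      fix i
      show "w $ i = 0 $ i"
        using orth[of "(i, 0)"] T(2) by (simp add: P_def y0 inner_axis')
    qed
  qed
  then obtain K :: "real^'n^'m" where "\<forall>j k. (\<Sum>p\<in>P. y (fst p) (snd p) $ k *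
      (v (fst p) (snd p) - K *v y (fst p) (snd p)) $ j) = 0" by (elim exE)
  then have K: "(\<Sum>p\<in>P. y (fst p) (snd p) $ k *
      (v (fst p) (snd p) - K *v y (fst p) (snd p)) $ j) = 0" for j k by (elim allE)
  have "norm l < \<alpha>" if ev: "complex_eigenvalue (A + B ** K) l" for l
  proof -
    obtain w where w: "w \<noteq> 0" "transpose (map_matrix complex_of_real (A + B ** K)) *v w = l *s w"
      using ev exists_left_eigenvector unfolding complex_eigenvalue_def by blast
    define e where "e t = (\<Sum>i\<in>UNIV. (norm (cfun w (y i t)))\<^sup>2)" for t
    define q where "q = (\<Sum>t<T. e t)"
    define r where "r p = v (fst p) (snd p) - K *v y (fst p) (snd p)" for p
    have split: "(\<Sum>p\<in>P. f (fst p) (snd p)) = (\<Sum>t<T. \<Sum>i\<in>UNIV. f i t)" for f :: "'n \<Rightarrow> nat \<Rightarrow> real"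
      unfolding P_def by (subst sum.swap) (simp add: sum.cartesian_product split_beta)
    \<comment> \<open>Writing the input as \<open>K *v ?y\<close> plus the residual isolates the
      closed-loop matrix, which \<open>w\<close> reduces to the factor \<open>l\<close>.\<close>
    have next_eq: "cfun w (\<alpha> *\<^sub>R y (fst p) (Suc (snd p)))
        = l * cfun w (y (fst p) (snd p)) + cfun (transpose (map_matrix of_real B) *v w) (r p)" for p
    proof -
      let ?y = "y (fst p) (snd p)" and ?v = "v (fst p) (snd p)"
      have "A *v ?y + B *v ?v = (A + B ** K) *v ?y + B *v r p"
        by (simp add: r_def matrix_vector_mult_add_rdistrib matrix_vector_mult_diff_distrib
            matrix_vector_mul_assoc)
      then show ?thesis
        unfolding yv by (simp only: cfun_add cfun_matrix w(2) cfun_scale)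
    qed
    have "(norm l)\<^sup>2 * q = (\<Sum>p\<in>P. (norm (l * cfun w (y (fst p) (snd p))))\<^sup>2)"
      unfolding split[of "\<lambda>i t. (norm (l * cfun w (y i t)))\<^sup>2"] q_def e_def
      by (simp add: sum_distrib_left norm_mult power_mult_distrib)
    also have "\<dots> \<le> (\<Sum>p\<in>P. (norm (cfun w (\<alpha> *\<^sub>R y (fst p) (Suc (snd p)))))\<^sup>2)"
      unfolding next_eq
    proof (rule sum_norm_power2_le_orthogonal)
      have "(\<Sum>p\<in>P. cnj (cfun w (y (fst p) (snd p))) *
          cfun (transpose (map_matrix of_real B) *v w) (r p)) = 0"
        by (rule sum_cnj_cfun_eq_0) (unfold r_def, rule K)
      then show "(\<Sum>p\<in>P. cnj (l * cfun w (y (fst p) (snd p))) *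
          cfun (transpose (map_matrix of_real B) *v w) (r p)) = 0"
        by (simp add: mult.assoc sum_distrib_left[symmetric])
    qed
    also have "\<dots> = \<alpha>\<^sup>2 * (\<Sum>t<T. e (Suc t))"
      unfolding split[of "\<lambda>i t. (norm (cfun w (\<alpha> *\<^sub>R y i (Suc t))))\<^sup>2"] e_def
      by (simp add: cfun_scaleR sum_distrib_left norm_mult power_mult_distrib)
    also have "\<dots> < \<alpha>\<^sup>2 * q"
    proof (rule mult_strict_left_mono)
      \<comment> \<open>Cauchy-Schwarz bounds the end points. On the unit vectors the functional
        returns the entries of \<open>w\<close>, so \<open>e 0\<close> is exactly
        \<open>(norm w)\<^sup>2\<close>.\<close>
      have "e T \<le> (\<Sum>i\<in>UNIV. (norm w)\<^sup>2 * (norm (y i T))\<^sup>2)"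
        unfolding e_def power_mult_distrib[symmetric]
        by (intro sum_mono power_mono norm_cfun_le) auto
      also have "\<dots> < (norm w)\<^sup>2"
        using T(1) w(1) by (simp add: sum_distrib_left[symmetric])
      also have "\<dots> = e 0"
        by (simp add: e_def y0 cfun_axis norm_power2_vec)
      finally have "e T < e 0" .
      \<comment> \<open>Both sides are the sum of \<open>e t\<close> over \<open>t \<le> T\<close>:
        the shift exchanges \<open>e 0\<close> for the smaller \<open>e T\<close>.\<close>
      moreover have "q + e T = e 0 + (\<Sum>t<T. e (Suc t))"
        unfolding q_def by (simp flip: sum.lessThan_Suc sum.lessThan_Suc_shift)
      ultimately show "(\<Sum>t<T. e (Suc t)) < q" by linarith
    qed (use \<alpha> in simp)
    finally have "(norm l)\<^sup>2 * q < \<alpha>\<^sup>2 * q" .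
    moreover have "0 \<le> q" unfolding q_def e_def by (intro sum_nonneg) auto
    ultimately have "(norm l)\<^sup>2 < \<alpha>\<^sup>2" by (metis mult_right_mono not_less)
    then show ?thesis using \<alpha> by (simp add: power2_less_imp_less)
  qed
  then show ?thesis unfolding stabilizable_def by auto
qed

section \<open>Robust stabilization\<close>

lemma xsol_Suc:
  "xsol S f g x0 z0 (Suc t) =
    fst S *v xsol S f g x0 z0 t + snd S *v g (xsol S f g x0 z0 t) (zsol S f g x0 z0 t)"
  by (simp add: xsol_def zsol_def split_beta)

text \<open>A closed-loop trajectory is an open-loop one whose input is the output of
  \<open>g\<close> along it.\<close>

lemma stabilizable_if_closed_loop_decay:
  fixes S :: "('n::finite, 'm::finite) sys"
  assumes "0 < \<alpha>"
    and decay: "\<And>x0. (\<lambda>t. norm (xsol S f g x0 z0 t) / \<alpha> ^ t) \<longlonglongrightarrow> 0"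
  shows "stabilizable \<alpha> S"
proof -
  have "stabilizable \<alpha> (fst S, snd S)"
  proof (rule stabilizable_if_asymptotically_controllable[OF assms(1)])
    fix x0
    show "\<exists>x u. x 0 = x0 \<and> (\<forall>t. x (Suc t) = fst S *v x t + snd S *v u t) \<and>
        (\<lambda>t. norm (x t) / \<alpha> ^ t) \<longlonglongrightarrow> 0"
      using decay[of x0]
      by (intro exI[of _ "xsol S f g x0 z0"]
          exI[of _ "\<lambda>t. g (xsol S f g x0 z0 t) (zsol S f g x0 z0 t)"])
        (simp add: xsol_Suc, simp add: xsol_def)
  qed
  then show ?thesis by simp
qed

lemma zero_in_Rspace: "(\<lambda>_. 0) \<in> Rspace p"
  by (simp add: Rspace_def topspace_Euclidean_space)

text \<open>Starting the controller at 0 is admissible, and a bound at rate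
  \<open>\<eta> < \<alpha>\<close> decays faster than \<open>\<alpha> ^ t\<close>.\<close>

lemma stabilizable_if_enables_robust_exp_stabilization:
  fixes \<Sigma> :: "('n::finite, 'm::finite) sys set"
  assumes "0 < \<alpha>" "enables_robust_exp_stabilization \<alpha> \<Sigma>"
  shows "\<Sigma> \<subseteq> Sigma_stab \<alpha>"
proof
  fix S assume S: "S \<in> \<Sigma>"
  from assms(2) obtain p f g c \<eta> where \<eta>: "0 \<le> \<eta>" "\<eta> < \<alpha>"
    and "\<forall>S\<in>\<Sigma>. \<forall>x0. \<forall>z0\<in>Rspace p. \<forall>t. norm (xsol S f g x0 z0 t) \<le> c * \<eta> ^ t * norm x0"
    unfolding enables_robust_exp_stabilization_def by auto
  then have bound: "norm (xsol S f g x0 (\<lambda>_. 0) t) \<le> c * \<eta> ^ t * norm x0" for x0 t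
    using S zero_in_Rspace by blast
  have "stabilizable \<alpha> S"
  proof (rule stabilizable_if_closed_loop_decay[OF assms(1)])
    fix x0 :: "real^'n"
    have "(\<lambda>t. c * (\<eta> / \<alpha>) ^ t * norm x0) \<longlonglongrightarrow> 0"
      using \<eta> assms(1)
      by (intro tendsto_mult_left_zero tendsto_mult_right_zero LIMSEQ_power_zero) simp
    then show "(\<lambda>t. norm (xsol S f g x0 (\<lambda>_. 0) t) / \<alpha> ^ t) \<longlonglongrightarrow> 0"
    proof (rule Lim_null_comparison[rotated], intro always_eventually allI)
      fix t
      show "norm (norm (xsol S f g x0 (\<lambda>_. 0) t) / \<alpha> ^ t) \<le> c * (\<eta> / \<alpha>) ^ t * norm x0"
        using bound[of x0 t] assms(1) by (simp add: power_divide field_simps)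
    qed
  qed
  then show "S \<in> Sigma_stab \<alpha>" by (simp add: Sigma_stab_def)
qed

text \<open>At rate 1 the required decay is convergence of \<open>x\<close> to 0.\<close>

lemma stabilizable_if_enables_robust_stabilization:
  assumes "enables_robust_stabilization \<Sigma>"
  shows "\<Sigma> \<subseteq> Sigma_stab 1"
proof
  fix S assume S: "S \<in> \<Sigma>"
  from assms obtain p f g where "\<forall>S\<in>\<Sigma>. globally_asymptotically_stable_x p S f g"
    unfolding enables_robust_stabilization_def by auto
  then have "(\<lambda>t. xsol S f g x0 (\<lambda>_. 0) t) \<longlonglongrightarrow> 0" for x0
    using S zero_in_Rspace unfolding globally_asymptotically_stable_x_def by blast
  then have "stabilizable 1 S"
    by (intro stabilizable_if_closed_loop_decay) (auto intro: tendsto_norm_zero)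
  then show "S \<in> Sigma_stab 1" by (simp add: Sigma_stab_def)
qed

lemma globally_asymptotically_stable_if_exp_decay:
  fixes S :: "('n::finite, 'm::finite) sys"
  assumes "1 \<le> c" "0 \<le> \<eta>" "\<eta> < 1"
    and bound: "\<And>x0 z0 t. z0 \<in> Rspace p \<Longrightarrow> norm (xsol S f g x0 z0 t) \<le> c * \<eta> ^ t * norm x0"
  shows "globally_asymptotically_stable_x p S f g"
  unfolding globally_asymptotically_stable_x_def Lyapunov_stable_x_def
proof (intro conjI allI impI ballI)
  fix \<epsilon> :: real assume \<epsilon>: "0 < \<epsilon>"
  show "\<exists>\<delta>>0. \<forall>x0. norm x0 \<le> \<delta> \<longrightarrow> (\<forall>t. \<forall>z0\<in>Rspace p. norm (xsol S f g x0 z0 t) \<le> \<epsilon>)"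
  \<comment> \<open>Since the powers of \<open>\<eta>\<close> are at most 1, \<open>c\<close> bounds
    the overshoot at all times.\<close>
  proof (intro exI[of _ "\<epsilon> / c"] conjI allI impI ballI)
    fix x0 :: "real^'n" and z0 t assume x0: "norm x0 \<le> \<epsilon> / c" and z0: "z0 \<in> Rspace p"
    have "norm (xsol S f g x0 z0 t) \<le> c * \<eta> ^ t * norm x0" by (rule bound[OF z0])
    also have "\<dots> \<le> c * 1 * (\<epsilon> / c)"
      using assms x0 by (intro mult_mono power_le_one) auto
    finally show "norm (xsol S f g x0 z0 t) \<le> \<epsilon>" using assms(1) by simp
  qed (use \<epsilon> assms(1) in simp)
next
  fix x0 :: "real^'n" and z0 assume z0: "z0 \<in> Rspace p"
  have "(\<lambda>t. c * \<eta> ^ t * norm x0) \<longlonglongrightarrow> 0"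
    using assms by (intro tendsto_mult_left_zero tendsto_mult_right_zero LIMSEQ_power_zero) simp
  then show "(\<lambda>t. xsol S f g x0 z0 t) \<longlonglongrightarrow> 0"
    by (rule Lim_null_comparison[rotated]) (use bound[OF z0] in simp)
qed

lemma enables_robust_stabilization_if_exp:
  assumes "enables_robust_exp_stabilization 1 \<Sigma>"
  shows "enables_robust_stabilization \<Sigma>"
proof -
  from assms obtain p f g c \<eta> where "1 \<le> p" and f: "\<forall>x. \<forall>z\<in>Rspace p. f x z \<in> Rspace p"
    and bz: "bounded_z p \<Sigma> f g" and c: "1 \<le> c" "0 \<le> \<eta>" "\<eta> < 1"
    and bound: "\<forall>S\<in>\<Sigma>. \<forall>x0. \<forall>z0\<in>Rspace p. \<forall>t. norm (xsol S f g x0 z0 t) \<le> c * \<eta> ^ t * norm x0"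
    unfolding enables_robust_exp_stabilization_def by auto
  have "globally_asymptotically_stable_x p S f g" if "S \<in> \<Sigma>" for S
    using bound that by (intro globally_asymptotically_stable_if_exp_decay[OF c]) blast
  then show ?thesis
    unfolding enables_robust_stabilization_def using \<open>1 \<le> p\<close> f bz by blast
qed

theorem theorem9:
  fixes \<Sigma>pk :: "('n::finite, 'm::finite) sys set" and \<alpha> :: real
  assumes "compact \<Sigma>pk" and "0 < \<alpha>" and "\<alpha> \<le> 1"
  shows "(enables_robust_exp_stabilization \<alpha> \<Sigma>pk \<longleftrightarrow> \<Sigma>pk \<subseteq> Sigma_stab \<alpha>) \<and>
    (enables_robust_stabilization \<Sigma>pk \<longleftrightarrow> enables_robust_exp_stabilization 1 \<Sigma>pk) \<and>
    (enables_robust_exp_stabilization 1 \<Sigma>pk \<longleftrightarrow> \<Sigma>pk \<subseteq> Sigma_stab 1)"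
proof -
  \<comment> \<open>Stated for every rate, since it is applied both at \<open>\<alpha>\<close> and
    at 1.\<close>
  have exp: "enables_robust_exp_stabilization \<beta> \<Sigma>pk \<longleftrightarrow> \<Sigma>pk \<subseteq> Sigma_stab \<beta>"
    if "0 < \<beta>" "\<beta> \<le> 1" for \<beta>
    using that enables_robust_exp_stabilization_if_stabilizable[OF assms(1)]
      stabilizable_if_enables_robust_exp_stabilization by blast
  show ?thesis
    \<comment> \<open>The equivalences close in a cycle: robust stabilization gives stabilizability,
      which gives exponential stabilization, which gives robust stabilization.\<close>
    using exp[OF assms(2,3)] exp[of 1] stabilizable_if_enables_robust_stabilization
      enables_robust_stabilization_if_exp by auto
qed

end
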